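(* Let $1\le m\le n$ be integers. The queen graph $Q_{m,n}$ is class 1 if at least one of $m$ and $n$ is even, or if $m=n$ and $n$ is odd. The graph $Q_{m,n}$ is class 2 if $m$ and $n$ are both odd and $n\ge \frac{1}{3}(2m^3-11m+18)$.
   Context: The queen graph $Q_{m,n}$ has as vertices the cells of an $m\times n$ grid, two distinct cells being adjacent iff they lie in the same row, the same column, or on the same diagonal or anti-diagonal (i.e., a chess queen can move between them). A graph $G$ is class 1 if its edge-chromatic number $\chi'(G)$ equals its maximum degree $\Delta(G)$, and class 2 if $\chi'(G)=\Delta(G)+1$. For $m\le n$, $\Delta(Q_{m,n})=3m+n-5$ if $m=n$ is even and $3m+n-4$ otherwise. *)

theory Defs
  imports Complex_Main
begin

text \<open>A graph is a pair of a vertex set and a set of edges; in a simple graph every edge is a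
  two-element set of vertices.\<close>

type_synonym 'a ugraph = "'a set \<times> 'a set set"

abbreviation vertices :: "'a ugraph \<Rightarrow> 'a set" where "vertices \<equiv> fst"
abbreviation edges :: "'a ugraph \<Rightarrow> 'a set set" where "edges \<equiv> snd"

definition finite_simple_graph :: "'a ugraph \<Rightarrow> bool" where
  "finite_simple_graph G \<longleftrightarrow>
     finite (vertices G) \<and> (\<forall>e\<in>edges G. e \<subseteq> vertices G \<and> card e = 2)"

definition degree :: "'a ugraph \<Rightarrow> 'a \<Rightarrow> nat" where
  "degree G v = card {e \<in> edges G. v \<in> e}"

text \<open>Only meaningful for graphs with a finite nonempty vertex set.\<close>

definition max_degree :: "'a ugraph \<Rightarrow> nat" where
  "max_degree G = Max (degree G ` vertices G)"

definition proper_edge_colouring :: "'a ugraph \<Rightarrow> nat \<Rightarrow> ('a set \<Rightarrow> nat) \<Rightarrow> bool" where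
  "proper_edge_colouring G k c \<longleftrightarrow>
     c ` edges G \<subseteq> {..<k} \<and>
     (\<forall>e\<in>edges G. \<forall>f\<in>edges G. e \<noteq> f \<and> e \<inter> f \<noteq> {} \<longrightarrow> c e \<noteq> c f)"

definition chromatic_index :: "'a ugraph \<Rightarrow> nat" where
  "chromatic_index G = (LEAST k. \<exists>c. proper_edge_colouring G k c)"

definition class_1 :: "'a ugraph \<Rightarrow> bool" where
  "class_1 G \<longleftrightarrow> chromatic_index G = max_degree G"

definition class_2 :: "'a ugraph \<Rightarrow> bool" where
  "class_2 G \<longleftrightarrow> chromatic_index G = max_degree G + 1"

text \<open>Cell \<open>(i, j)\<close> lies in row \<open>i\<close> and column \<open>j\<close>; differences are taken in the integers
  because subtraction of natural numbers truncates.\<close>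

fun queen_adj :: "nat \<times> nat \<Rightarrow> nat \<times> nat \<Rightarrow> bool" where
  "queen_adj (i, j) (i', j') \<longleftrightarrow>
     (i, j) \<noteq> (i', j') \<and>
     (i = i' \<or> j = j' \<or> int i - int j = int i' - int j' \<or> i + j = i' + j')"

definition queen_graph :: "nat \<Rightarrow> nat \<Rightarrow> (nat \<times> nat) ugraph" where
  "queen_graph m n =
     (let V = {1..m} \<times> {1..n} in (V, {{u, v} | u v. u \<in> V \<and> v \<in> V \<and> queen_adj u v}))"

lemma queen_graph_simple: "finite_simple_graph (queen_graph m n)"
proof -
  have irrefl: "u \<noteq> v" if "queen_adj u v" for u v
  proof
    assume "u = v"
    with that show False by (cases v) simp
  qed
  have "e \<subseteq> vertices (queen_graph m n) \<and> card e = 2" if e: "e \<in> edges (queen_graph m n)" for e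
  proof -
    obtain u v where "e = {u, v}" "u \<in> {1..m} \<times> {1..n}" "v \<in> {1..m} \<times> {1..n}" "queen_adj u v"
      using e unfolding queen_graph_def Let_def snd_conv by blast
    then show ?thesis
      using irrefl[of u v] by (simp add: queen_graph_def Let_def)
  qed
  moreover have "finite (vertices (queen_graph m n))"
    by (simp add: queen_graph_def Let_def)
  ultimately show ?thesis
    unfolding finite_simple_graph_def by blast
qed

text \<open>The minimum in the definition of \<open>chromatic_index\<close> is attained for finite graphs.\<close>

lemma chromatic_index_attained:
  assumes "finite_simple_graph G"
  shows "\<exists>c. proper_edge_colouring G (chromatic_index G) c"
proof -
  have "edges G \<subseteq> Pow (vertices G)" "finite (vertices G)"
    using assms by (auto simp: finite_simple_graph_def)
  then have "finite (edges G)"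
    by (simp add: finite_subset)
  then obtain c where "bij_betw c (edges G) {0..<card (edges G)}"
    using ex_bij_betw_finite_nat by blast
  then have "proper_edge_colouring G (card (edges G)) c"
    by (auto simp: proper_edge_colouring_def bij_betw_def inj_on_def)
  then have "\<exists>k c. proper_edge_colouring G k c"
    by blast
  then show ?thesis
    unfolding chromatic_index_def by (rule LeastI_ex)
qed

end

theory Submission
  imports Defs
begin

text \<open>Orient every bishop edge to the right and classify it by its row displacement modulo \<open>m\<close>.
  Each of the \<open>m - 1\<close> classes is a disjoint union of paths, so two colours per class suffice and the
  bishop edges take \<open>2 * m - 2\<close> colours (one less if \<open>m = n\<close> is even, where a class is a matching).
  Rook edges take \<open>m + n - 2\<close> colours if \<open>m * n\<close> is even and \<open>m + n - 1\<close> in general, because a cyclic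
  colouring of the columns misses one colour in each row, which the row can reuse. For \<open>m = n\<close> odd
  the rook edges need two further colours, which are taken from two nearly unused bishop
  colours. A central cell attains the resulting number of colours as its degree, except when
  \<open>m < n\<close> are odd; then the colouring has one colour more than the maximum degree, and for large
  \<open>n\<close> the graph has too many edges for fewer colours, as a colour class has at most
  \<open>(m * n - 1) / 2\<close> edges.\<close>

section \<open>Edge colourings\<close>

text \<open>An edge is an ordered pair related by a symmetric \<open>R\<close>, so that colours can
  be given by formulas in the two end points and compared at a common first end point. Colours may
  have any type; in the end only the size of the palette \<open>C\<close> counts.\<close>

definition local_colouring :: "('v \<Rightarrow> 'v \<Rightarrow> bool) \<Rightarrow> ('v \<Rightarrow> 'v \<Rightarrow> 'c) \<Rightarrow> 'c set \<Rightarrow> bool" where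
  "local_colouring R c C \<longleftrightarrow>
     (\<forall>u v. R u v \<longrightarrow> R v u \<and> c u v \<in> C \<and> c u v = c v u) \<and>
     (\<forall>u v w. R u v \<longrightarrow> R u w \<longrightarrow> c u v = c u w \<longrightarrow> v = w)"

lemma local_colouringI:
  assumes "\<And>u v. R u v \<Longrightarrow> R v u" "\<And>u v. R u v \<Longrightarrow> c u v \<in> C"
    "\<And>u v. R u v \<Longrightarrow> c u v = c v u"
    "\<And>u v w. R u v \<Longrightarrow> R u w \<Longrightarrow> c u v = c u w \<Longrightarrow> v = w"
  shows "local_colouring R c C"
  using assms unfolding local_colouring_def by blast

lemma local_colouringD:
  assumes "local_colouring R c C" "R u v"
  shows "R v u" "c u v \<in> C" "c u v = c v u" "R u w \<Longrightarrow> c u v = c u w \<Longrightarrow> v = w"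
  using assms unfolding local_colouring_def by blast+

text \<open>Colours of the two relations conflict only at a common vertex, and \<open>sep\<close>
  excludes just that. The palettes may overlap, which lets rook edges reuse bishop colours.\<close>

lemma local_colouring_join:
  assumes 1: "local_colouring R c C" and 2: "local_colouring S d D"
    and sep: "\<And>u v w. R u v \<Longrightarrow> S u w \<Longrightarrow> c u v \<noteq> d u w"
  shows "local_colouring (\<lambda>u v. R u v \<or> S u v) (\<lambda>u v. if R u v then c u v else d u v) (C \<union> D)"
proof (rule local_colouringI)
  fix u v assume uv: "R u v \<or> S u v"
  show "R v u \<or> S v u"
    using uv local_colouringD(1)[OF 1] local_colouringD(1)[OF 2] by blast
  show "(if R u v then c u v else d u v) \<in> C \<union> D"
    using uv local_colouringD(2)[OF 1] local_colouringD(2)[OF 2] by auto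
  show "(if R u v then c u v else d u v) = (if R v u then c v u else d v u)"
    using uv local_colouringD(1,3)[OF 1] local_colouringD(3)[OF 2] by metis
next
  fix u v w
  assume "R u v \<or> S u v" "R u w \<or> S u w"
    "(if R u v then c u v else d u v) = (if R u w then c u w else d u w)"
  then show "v = w"
    using local_colouringD(4)[OF 1] local_colouringD(4)[OF 2] sep by metis
qed

lemma local_colouring_vimage:
  assumes "local_colouring R c C" "inj h"
  shows "local_colouring (\<lambda>u v. R (h u) (h v)) (\<lambda>u v. c (h u) (h v)) C"
  using assms unfolding local_colouring_def inj_def by blast

lemma local_colouring_imp_proper:
  assumes R: "local_colouring R c C" and C: "finite C" "card C \<le> k"
  shows "\<exists>c'. proper_edge_colouring (V, {{u, v} | u v. R u v}) k c'"
proof -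
  from C obtain h where h: "h ` C \<subseteq> {..<k}" "inj_on h C"
    using card_le_inj[of C "{..<k}"] by auto
  \<comment> \<open>On an edge the description has exactly one value, since \<open>{u, v}\<close>
    determines its ends up to order and \<open>c\<close> is symmetric; \<open>h\<close> renumbers
    the palette by numbers below \<open>k\<close>.\<close>
  define c' where "c' e = h (THE x. \<exists>u v. e = {u, v} \<and> R u v \<and> x = c u v)" for e
  have c': "c' {u, v} = h (c u v)" if "R u v" for u v
  proof -
    have "(THE x. \<exists>a b. {u, v} = {a, b} \<and> R a b \<and> x = c a b) = c u v"
      using that local_colouringD(3)[OF R]
      by (intro the_equality) (auto simp: doubleton_eq_iff)
    then show ?thesis by (simp add: c'_def)
  qed
  have ends: "\<exists>v. e = {x, v} \<and> R x v" if "e \<in> {{u, v} | u v. R u v}" "x \<in> e" for e x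
    using that local_colouringD(1)[OF R] by fastforce
  have "proper_edge_colouring (V, {{u, v} | u v. R u v}) k c'"
    unfolding proper_edge_colouring_def snd_conv
  proof (intro conjI ballI impI)
    show "c' ` {{u, v} | u v. R u v} \<subseteq> {..<k}"
      using c' h(1) local_colouringD(2)[OF R] by fastforce
    fix e f assume e: "e \<in> {{u, v} | u v. R u v}" and f: "f \<in> {{u, v} | u v. R u v}"
      and ef: "e \<noteq> f \<and> e \<inter> f \<noteq> {}"
    then obtain x where x: "x \<in> e" "x \<in> f" by blast
    obtain v w where "e = {x, v}" "R x v" "f = {x, w}" "R x w"
      using ends[OF e x(1)] ends[OF f x(2)] by blast
    then show "c' e \<noteq> c' f"
      using ef c' h(2) local_colouringD(2,4)[OF R] by (metis inj_onD)
  qed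
  then show ?thesis by blast
qed

section \<open>Bounds on the chromatic index from degrees and from matchings\<close>

lemma chromatic_index_le:
  "proper_edge_colouring G k c \<Longrightarrow> chromatic_index G \<le> k"
  unfolding chromatic_index_def by (rule Least_le) blast

lemma degree_le_colours:
  assumes "proper_edge_colouring G k c"
  shows "degree G v \<le> k"
proof -
  have "inj_on c {e \<in> edges G. v \<in> e}" "c ` {e \<in> edges G. v \<in> e} \<subseteq> {..<k}"
    using assms unfolding proper_edge_colouring_def inj_on_def by blast+
  then have "card {e \<in> edges G. v \<in> e} \<le> card {..<k}"
    by (rule card_inj_on_le) simp
  then show ?thesis by (simp add: degree_def)
qed

lemma degree_le_max_degree:
  assumes "finite_simple_graph G" "v \<in> vertices G"
  shows "degree G v \<le> max_degree G"
  using assms unfolding max_degree_def finite_simple_graph_def by auto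

text \<open>All terms agree in the cycle \<open>k \<le> degree G v \<le> max_degree G \<le>
  chromatic_index G \<le> k\<close>.\<close>

lemma class_1I:
  assumes G: "finite_simple_graph G" and c: "proper_edge_colouring G k c"
    and v: "v \<in> vertices G" "k \<le> degree G v"
  shows "class_1 G"
proof -
  obtain c' where c': "proper_edge_colouring G (chromatic_index G) c'"
    using chromatic_index_attained[OF G] by blast
  have "max_degree G \<le> chromatic_index G"
    unfolding max_degree_def
    using G v(1) degree_le_colours[OF c'] by (subst Max_le_iff) (auto simp: finite_simple_graph_def)
  moreover have "chromatic_index G \<le> k" by (rule chromatic_index_le[OF c])
  moreover have "k \<le> max_degree G" using v degree_le_max_degree[OF G v(1)] by simp
  ultimately show ?thesis by (simp add: class_1_def)
qed

text \<open>A colour class is a matching and covers an even number of vertices, so in a graph of odd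
  order it misses at least one.\<close>

lemma card_edges_le_odd_order:
  assumes G: "finite_simple_graph G" and c: "proper_edge_colouring G k c"
    and odd: "odd (card (vertices G))"
  shows "2 * card (edges G) \<le> k * (card (vertices G) - 1)"
proof -
  have finV: "finite (vertices G)" and E: "\<And>e. e \<in> edges G \<Longrightarrow> e \<subseteq> vertices G \<and> card e = 2"
    using G by (auto simp: finite_simple_graph_def)
  then have finE: "finite (edges G)"
    by (meson PowI finite_Pow_iff finite_subset subsetI)
  define M where "M x = {e \<in> edges G. c e = x}" for x
  have M: "2 * card (M x) \<le> card (vertices G) - 1" for x
  proof -
    have "pairwise disjnt (M x)"
      using c unfolding proper_edge_colouring_def M_def pairwise_def disjnt_def by blast
    then have "card (\<Union> (M x)) = (\<Sum>e\<in>M x. card e)"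
      using E finV by (intro card_Union_disjoint) (auto simp: M_def intro: finite_subset)
    also have "\<dots> = (\<Sum>e\<in>M x. 2)"
      using E by (intro sum.cong) (auto simp: M_def)
    finally have "card (\<Union> (M x)) = 2 * card (M x)" by simp
    moreover have "card (\<Union> (M x)) \<le> card (vertices G)"
      using E finV by (intro card_mono) (auto simp: M_def)
    ultimately show ?thesis using odd by presburger
  qed
  have "edges G = (\<Union>x\<in>{..<k}. M x)"
    using c unfolding proper_edge_colouring_def M_def by auto
  then have "card (edges G) \<le> (\<Sum>x<k. card (M x))"
    using card_UN_le[of "{..<k}" M] by simp
  then have "2 * card (edges G) \<le> (\<Sum>x<k. 2 * card (M x))"
    by (simp flip: sum_distrib_left)
  also have "\<dots> \<le> (\<Sum>x<k. card (vertices G) - 1)"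
    by (intro sum_mono M)
  finally show ?thesis by simp
qed

text \<open>The graph is overfull: \<open>k\<close> matchings, each missing a vertex, cannot hold
  all edges, while \<open>k\<close> is the maximum degree.\<close>

lemma class_2I:
  assumes G: "finite_simple_graph G" and c: "proper_edge_colouring G (Suc k) c"
    and v: "v \<in> vertices G" "k \<le> degree G v"
    and deg: "\<And>u. u \<in> vertices G \<Longrightarrow> degree G u \<le> k"
    and odd: "odd (card (vertices G))"
    and overfull: "k * (card (vertices G) - 1) < 2 * card (edges G)"
  shows "class_2 G"
proof -
  obtain c' where c': "proper_edge_colouring G (chromatic_index G) c'"
    using chromatic_index_attained[OF G] by blast
  have "max_degree G \<le> k"
    unfolding max_degree_def
    using G v(1) deg by (subst Max_le_iff) (auto simp: finite_simple_graph_def)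
  moreover have "k \<le> max_degree G" using v degree_le_max_degree[OF G v(1)] by simp
  moreover have "chromatic_index G \<le> Suc k" by (rule chromatic_index_le[OF c])
  moreover have "\<not> chromatic_index G \<le> k"
  proof
    assume "chromatic_index G \<le> k"
    then have "chromatic_index G * (card (vertices G) - 1) \<le> k * (card (vertices G) - 1)"
      by (rule mult_right_mono) simp
    then show False
      using card_edges_le_odd_order[OF G c' odd] overfull by linarith
  qed
  ultimately show ?thesis by (simp add: class_2_def)
qed

section \<open>Rook moves\<close>

type_synonym cell = "nat \<times> nat"

fun row_adj :: "nat \<Rightarrow> nat \<Rightarrow> cell \<Rightarrow> cell \<Rightarrow> bool" where
  "row_adj m n (i, j) (i', j') \<longleftrightarrow>
     i = i' \<and> j \<noteq> j' \<and> i \<in> {1..m} \<and> j \<in> {1..n} \<and> j' \<in> {1..n}"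

fun col_adj :: "nat \<Rightarrow> nat \<Rightarrow> cell \<Rightarrow> cell \<Rightarrow> bool" where
  "col_adj m n (i, j) (i', j') \<longleftrightarrow>
     j = j' \<and> i \<noteq> i' \<and> j \<in> {1..n} \<and> i \<in> {1..m} \<and> i' \<in> {1..m}"

abbreviation rook_adj :: "nat \<Rightarrow> nat \<Rightarrow> cell \<Rightarrow> cell \<Rightarrow> bool" where
  "rook_adj m n u v \<equiv> row_adj m n u v \<or> col_adj m n u v"

lemma mod_eq_imp_eq:
  fixes a b n :: nat
  assumes "a mod n = b mod n" "a \<in> {1..n}" "b \<in> {1..n}"
  shows "a = b"
proof (rule ccontr)
  assume "a \<noteq> b"
  then consider "a < b" | "b < a" by linarith
  then show False
  proof cases
    case 1
    then have "n dvd b - a" using assms(1) by (metis less_imp_le mod_eq_dvd_iff_nat)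
    then show False using 1 assms dvd_imp_le[of n "b - a"] by auto
  next
    case 2
    then have "n dvd a - b" using assms(1) by (metis less_imp_le mod_eq_dvd_iff_nat)
    then show False using 2 assms dvd_imp_le[of n "a - b"] by auto
  qed
qed

lemma add_mod_eq_imp_eq:
  fixes a b x n :: nat
  assumes "(x + a) mod n = (x + b) mod n" "a \<in> {1..n}" "b \<in> {1..n}"
  shows "a = b"
proof -
  have "int (x + a) mod int n = int (x + b) mod int n"
    using assms(1) by (metis of_nat_mod)
  then have "int a mod int n = int b mod int n"
    by (simp add: mod_eq_dvd_iff)
  then have "a mod n = b mod n" by (metis of_nat_eq_iff of_nat_mod)
  then show ?thesis using assms mod_eq_imp_eq by blast
qed

text \<open>A proper edge colouring of the complete graph on \<open>{1..n}\<close> with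
  \<open>p\<close> colours, meant for the pairs of columns within a row.\<close>

definition complete_colouring :: "nat \<Rightarrow> nat \<Rightarrow> (nat \<Rightarrow> nat \<Rightarrow> nat) \<Rightarrow> bool" where
  "complete_colouring n p g \<longleftrightarrow>
     local_colouring (\<lambda>a b. a \<in> {1..n} \<and> b \<in> {1..n} \<and> a \<noteq> b) g {..<p}"

text \<open>At \<open>a\<close> the sums take every residue except that of \<open>2 * a\<close>,
  which stays free.\<close>

lemma complete_colouring_sum:
  "complete_colouring n n (\<lambda>a b. (a + b) mod n)"
  unfolding complete_colouring_def
proof (rule local_colouringI)
  fix u v w assume "u \<in> {1..n} \<and> v \<in> {1..n} \<and> u \<noteq> v" "u \<in> {1..n} \<and> w \<in> {1..n} \<and> u \<noteq> w"
    "(u + v) mod n = (u + w) mod n"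
  then show "v = w" using add_mod_eq_imp_eq by blast
qed (auto simp: add.commute)

text \<open>For even \<open>n\<close>, the last vertex joined to \<open>a\<close> takes the colour \<open>2 * a\<close> that the cyclic
  colouring of the first \<open>n - 1\<close> vertices leaves free at \<open>a\<close>; these colours are distinct
  because \<open>n - 1\<close> is odd.\<close>

lemma complete_colouring_even:
  assumes "even n" "0 < n"
  shows "\<exists>g. complete_colouring n (n - 1) g"
proof -
  define p where "p = n - 1"
  have p: "odd p" "n = Suc p" using assms by (auto simp: p_def)
  define g where
    "g a b = (if a = n then b + b else if b = n then a + a else a + b) mod p" for a b
  have double: "a = b" if "(a + a) mod p = (b + b) mod p" "a \<in> {1..p}" "b \<in> {1..p}" for a b
  proof -
    have "int p dvd 2 * (int a - int b)"
    proof -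
      have "int (a + a) mod int p = int (b + b) mod int p"
        using that(1) by (metis of_nat_mod)
      then show ?thesis by (simp add: mod_eq_dvd_iff algebra_simps)
    qed
    moreover have "coprime (int p) 2" using p(1) by simp
    ultimately have "int p dvd int a - int b"
      using coprime_dvd_mult_right_iff by blast
    then have "a mod p = b mod p"
      by (metis mod_eq_dvd_iff of_nat_eq_iff of_nat_mod)
    then show ?thesis using that mod_eq_imp_eq by blast
  qed
  have "complete_colouring n p g"
    unfolding complete_colouring_def
  proof (rule local_colouringI)
    fix u v assume "u \<in> {1..n} \<and> v \<in> {1..n} \<and> u \<noteq> v"
    then show "g u v \<in> {..<p}" using p by (auto simp: g_def odd_pos)
    show "g u v = g v u" by (auto simp: g_def add.commute)
  next
    fix u v w assume *: "u \<in> {1..n} \<and> v \<in> {1..n} \<and> u \<noteq> v" "u \<in> {1..n} \<and> w \<in> {1..n} \<and> u \<noteq> w"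
      "g u v = g u w"
    have le: "x \<in> {1..p}" if "x \<in> {1..n}" "x \<noteq> n" for x using that p by auto
    show "v = w"
    proof (cases "u = n")
      case True
      then show ?thesis using * le double[of v w] by (auto simp: g_def)
    next
      case False
      then show ?thesis
        using * le[of u] le[of v] le[of w] add_mod_eq_imp_eq[of u v p w]
          add_mod_eq_imp_eq[of u u p w] add_mod_eq_imp_eq[of u v p u]
        by (auto simp: g_def split: if_splits)
    qed
  qed auto
  then show ?thesis by (auto simp: p_def)
qed

text \<open>The first component is \<open>0\<close> for bishop, \<open>1\<close> for row and
  \<open>2\<close> for column colours. The second is a step class or a residue; the third tells
  apart the two colours of a bishop class.\<close>

type_synonym colour = "nat \<times> nat \<times> nat"

text \<open>Colour \<open>0\<close> of a row is replaced by the one colour missing there in all columns.\<close>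

lemma rook_colouring:
  assumes g: "complete_colouring n p g" and p: "0 < p"
  shows "\<exists>c :: cell \<Rightarrow> cell \<Rightarrow> colour. \<exists>C. local_colouring (rook_adj m n) c C \<and>
           C \<subseteq> {1..} \<times> UNIV \<and> finite C \<and> card C \<le> m + p - 1"
proof -
  \<comment> \<open>The value \<open>2 * fst u mod m\<close> is what \<open>?cc\<close> would give
    to a loop at \<open>u\<close>: no column edge at \<open>u\<close> has it, and it is constant
    along the row.\<close>
  let ?rc = "\<lambda>u v. let x = g (snd u) (snd v) in
     if x = 0 then (2, 2 * fst u mod m, 0) else (1, x, 0) :: colour"
  let ?cc = "\<lambda>u v. (2, (fst u + fst v) mod m, 0) :: colour"
  let ?C = "Pair 2 ` ((\<lambda>x. (x, 0)) ` {..<m}) :: colour set"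
  let ?R = "Pair 1 ` ((\<lambda>x. (x, 0)) ` {1..<p}) :: colour set"
  note gD = local_colouringD[OF g[unfolded complete_colouring_def]]
  have row: "local_colouring (row_adj m n) ?rc (?R \<union> ?C)"
  proof (rule local_colouringI)
    fix u v assume uv: "row_adj m n u v"
    then show "row_adj m n v u" by (cases u; cases v) auto
    have x: "g (snd u) (snd v) < p" "g (snd u) (snd v) = g (snd v) (snd u)"
      using uv gD(2,3)[of "snd u" "snd v"] by (cases u; cases v; auto)+
    have f: "fst u = fst v" "0 < m" using uv by (cases u; cases v; auto)+
    show "?rc u v \<in> ?R \<union> ?C" using x f by (auto simp: Let_def)
    show "?rc u v = ?rc v u" using x f by (auto simp: Let_def)
  next
    fix u v w assume "row_adj m n u v" "row_adj m n u w" "?rc u v = ?rc u w"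
    then show "v = w" using gD(4)[of "snd u" "snd v" "snd w"]
      by (cases u; cases v; cases w) (auto simp: Let_def split: if_splits)
  qed
  have col: "local_colouring (col_adj m n) ?cc ?C"
  proof (rule local_colouringI)
    fix u v w assume "col_adj m n u v" "col_adj m n u w" "?cc u v = ?cc u w"
    then show "v = w" using add_mod_eq_imp_eq[of "fst u" "fst v" m "fst w"]
      by (cases u; cases v; cases w) auto
  next
    fix u v assume uv: "col_adj m n u v"
    then show "col_adj m n v u" "?cc u v \<in> ?C" "?cc u v = ?cc v u"
      by (cases u; cases v; auto simp: add.commute)+
  qed
  have sep: "?rc u v \<noteq> ?cc u w" if "row_adj m n u v" "col_adj m n u w" for u v w
    using that add_mod_eq_imp_eq[of "fst u" "fst u" m "fst w"]
    by (cases u; cases v; cases w) (auto simp: Let_def mult_2)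
  have "card ((?R \<union> ?C) \<union> ?C) \<le> card ?R + card ?C"
    using card_Un_le[of ?R ?C] by (simp add: Un_assoc)
  also have "\<dots> \<le> (p - 1) + m"
    using card_image_le[of "{1..<p}" "\<lambda>x. (x, 0)"] card_image_le[of "{..<m}" "\<lambda>x. (x, 0)"]
    by (intro add_mono) (auto intro!: order_trans[OF card_image_le])
  finally have "card ((?R \<union> ?C) \<union> ?C) \<le> m + p - 1" using p by simp
  then show ?thesis
    using local_colouring_join[OF row col sep]
    by (intro exI[of _ "\<lambda>u v. if row_adj m n u v then ?rc u v else ?cc u v"]
        exI[of _ "(?R \<union> ?C) \<union> ?C"]) auto
qed

text \<open>Transposing the board serves the case in which only the number of rows is even.\<close>

lemma rook_colouring_swap:
  assumes "local_colouring (rook_adj m n) c C"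
  shows "\<exists>c'. local_colouring (rook_adj n m) c' C"
proof -
  have "(\<lambda>u v. rook_adj m n (prod.swap u) (prod.swap v)) = rook_adj n m"
    by (intro ext) auto
  then show ?thesis
    using local_colouring_vimage[OF assms, of prod.swap] by (metis inj_swap)
qed

section \<open>Bishop moves\<close>

text \<open>The step relation of class \<open>d\<close> moves \<open>d\<close> rows forward cyclically, always to the right along
  a diagonal or an anti-diagonal. Each class is therefore a disjoint union of paths.\<close>

fun step :: "nat \<Rightarrow> nat \<Rightarrow> nat \<Rightarrow> cell \<Rightarrow> cell \<Rightarrow> bool" where
  "step m n d (i, j) (i', j') \<longleftrightarrow>
     0 < d \<and> d < m \<and> i \<in> {1..m} \<and> i' \<in> {1..m} \<and> j \<in> {1..n} \<and> j' \<in> {1..n} \<and>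
     (i' = i + d \<and> j' = j + d \<or> i = i' + (m - d) \<and> j' = j + (m - d))"

definition bishop_adj :: "nat \<Rightarrow> nat \<Rightarrow> cell \<Rightarrow> cell \<Rightarrow> bool" where
  "bishop_adj m n u v \<longleftrightarrow> (\<exists>d. step m n d u v \<or> step m n d v u)"

text \<open>Orient a bishop move to the right. If it keeps \<open>i - j\<close>, its class is the
  row difference; if it keeps \<open>i + j\<close>, the row number falls and the class is
  \<open>m\<close> minus the row difference.\<close>

lemma queen_adj_eq:
  "(u \<in> {1..m} \<times> {1..n} \<and> v \<in> {1..m} \<times> {1..n} \<and> queen_adj u v) \<longleftrightarrow>
     rook_adj m n u v \<or> bishop_adj m n u v"
proof -
  obtain i j i' j' where uv: "u = (i, j)" "v = (i', j')" by (cases u; cases v)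
  show ?thesis
  proof
    assume *: "u \<in> {1..m} \<times> {1..n} \<and> v \<in> {1..m} \<times> {1..n} \<and> queen_adj u v"
    show "rook_adj m n u v \<or> bishop_adj m n u v"
    proof (cases "i = i' \<or> j = j'")
      case True
      then show ?thesis using * by (auto simp: uv)
    next
      case False
      then have "i < i' \<or> i' < i" "int i - int j = int i' - int j' \<or> i + j = i' + j'"
        using * by (auto simp: uv)
      then consider "i < i'" "int i - int j = int i' - int j'" | "i' < i" "int i - int j = int i' - int j'"
        | "i < i'" "i + j = i' + j'" | "i' < i" "i + j = i' + j'"
        by blast
      then have "bishop_adj m n u v"
      proof cases
        case 1
        then have "step m n (i' - i) u v" using * by (auto simp: uv)
        then show ?thesis by (auto simp: bishop_adj_def)
      next
        case 2
        then have "step m n (i - i') v u" using * by (auto simp: uv)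
        then show ?thesis by (auto simp: bishop_adj_def)
      next
        case 3
        then have "step m n (m - (i' - i)) v u" using * by (auto simp: uv)
        then show ?thesis by (auto simp: bishop_adj_def)
      next
        case 4
        then have "step m n (m - (i - i')) u v" using * by (auto simp: uv)
        then show ?thesis by (auto simp: bishop_adj_def)
      qed
      then show ?thesis by simp
    qed
  next
    assume "rook_adj m n u v \<or> bishop_adj m n u v"
    then show "u \<in> {1..m} \<times> {1..n} \<and> v \<in> {1..m} \<times> {1..n} \<and> queen_adj u v"
      by (auto simp: uv bishop_adj_def)
  qed
qed

definition step_class :: "nat \<Rightarrow> cell \<Rightarrow> cell \<Rightarrow> nat" where
  "step_class m u v = (if fst u < fst v then fst v - fst u else m - (fst u - fst v))"

text \<open>Comparing columns finds the left end, which makes the colour symmetric;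
  \<open>s d u\<close> selects the colour within class \<open>d\<close> of the step leaving
  \<open>u\<close>.\<close>

definition bishop_colour :: "nat \<Rightarrow> (nat \<Rightarrow> cell \<Rightarrow> nat) \<Rightarrow> cell \<Rightarrow> cell \<Rightarrow> colour" where
  "bishop_colour m s u v =
     (if snd u < snd v then (0, step_class m u v, s (step_class m u v) u)
      else (0, step_class m v u, s (step_class m v u) v))"

lemma step_class_eq: "step m n d u v \<Longrightarrow> step_class m u v = d"
  by (cases u; cases v) (auto simp: step_class_def)

lemma step_right: "step m n d u v \<Longrightarrow> snd u < snd v"
  by (cases u; cases v) auto

lemma bishop_colour_step:
  assumes "step m n d u v"
  shows "bishop_colour m s u v = (0, d, s d u)" "bishop_colour m s v u = (0, d, s d u)"
  using step_class_eq[OF assms] step_right[OF assms] by (auto simp: bishop_colour_def)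

text \<open>From row \<open>i\<close>, adding \<open>d\<close> requires \<open>i \<le> m - d\<close>
  and subtracting \<open>m - d\<close> requires \<open>i > m - d\<close>, so at most one of the two
  stays on the board. For incoming steps the conditions on the target row are \<open>> d\<close> and
  \<open>\<le> d\<close>.\<close>

lemma step_unique:
  "step m n d u v \<Longrightarrow> step m n d u w \<Longrightarrow> v = w"
  "step m n d v u \<Longrightarrow> step m n d w u \<Longrightarrow> v = w"
  by (cases u; cases v; cases w; auto)+

text \<open>Equal colours force equal classes. Within a class, two steps leaving or two steps
  entering a cell coincide, so a conflict needs one step after another, and there \<open>s\<close>
  changes.\<close>

lemma bishop_colouring:
  assumes s: "\<And>d u v w. step m n d u v \<Longrightarrow> step m n d v w \<Longrightarrow> s d u \<noteq> s d v"
    and C: "\<And>d u v. step m n d u v \<Longrightarrow> (0, d, s d u) \<in> C"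
  shows "local_colouring (bishop_adj m n) (bishop_colour m s) C"
proof (rule local_colouringI)
  fix u v assume uv: "bishop_adj m n u v"
  then show "bishop_adj m n v u" by (auto simp: bishop_adj_def)
  show "bishop_colour m s u v \<in> C" "bishop_colour m s u v = bishop_colour m s v u"
    using uv unfolding bishop_adj_def by (auto simp: bishop_colour_step C simp del: step.simps)
next
  fix u v w
  assume uv: "bishop_adj m n u v" and uw: "bishop_adj m n u w"
    and eq: "bishop_colour m s u v = bishop_colour m s u w"
  obtain d e where d: "step m n d u v \<or> step m n d v u" and e: "step m n e u w \<or> step m n e w u"
    using uv uw by (auto simp: bishop_adj_def)
  have "d = e" using d e eq by (auto simp: bishop_colour_step)
  with e have e: "step m n d u w \<or> step m n d w u" by simp
  show "v = w"
    using d
  proof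
    assume uv: "step m n d u v"
    have "\<not> step m n d w u"
      using eq s[OF _ uv, of w] by (auto simp: bishop_colour_step[OF uv] bishop_colour_step)
    then show ?thesis using e step_unique(1)[OF uv] by blast
  next
    assume vu: "step m n d v u"
    have "\<not> step m n d u w"
      using eq s[OF vu, of w] by (auto simp: bishop_colour_step[OF vu] bishop_colour_step)
    then show ?thesis using e step_unique(2)[OF vu] by blast
  qed
qed

text \<open>A step of class \<open>d\<close> either increases \<open>i + j\<close> by \<open>2 * d\<close> and keeps \<open>j - i\<close>, or
  keeps \<open>i + j\<close> and increases \<open>j - i\<close> by \<open>2 * (m - d)\<close>; so the sum below grows by one.
  The summand \<open>m\<close> only avoids truncated subtraction.\<close>

definition parity :: "nat \<Rightarrow> nat \<Rightarrow> cell \<Rightarrow> nat" where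
  "parity m d u =
     ((fst u + snd u) div (2 * d) + (snd u + m - fst u) div (2 * (m - d))) mod 2"

lemma parity_zero_or_one: "parity m d u \<in> {0, 1}"
  unfolding parity_def by (metis insert_iff mod2_eq_if)

lemma step_bounds: "step m n d u v \<Longrightarrow> 0 < d \<and> d < m"
  by (cases u; cases v) simp

lemma parity_step:
  assumes "step m n d u v"
  shows "parity m d u \<noteq> parity m d v"
proof -
  obtain i j i' j' where uv: "u = (i, j)" "v = (i', j')" by (cases u; cases v)
  have d: "0 < 2 * d" "0 < 2 * (m - d)" and im: "i \<le> m" using assms by (auto simp: uv)
  from assms consider "i' = i + d" "j' = j + d" | "i = i' + (m - d)" "j' = j + (m - d)"
    by (auto simp: uv)
  then show ?thesis
  proof cases
    case 1
    have "i' + j' = (i + j) + 2 * d" using 1 by simp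
    then have "(i' + j') div (2 * d) = Suc ((i + j) div (2 * d))"
      using div_add_self2[of "2 * d" "i + j"] d by simp
    moreover have "j' + m - i' = j + m - i" using 1 by simp
    ultimately show ?thesis by (simp add: parity_def uv mod_Suc)
  next
    case 2
    have "j' + m - i' = (j + m - i) + 2 * (m - d)" using 2 im by simp
    then have "(j' + m - i') div (2 * (m - d)) = Suc ((j + m - i) div (2 * (m - d)))"
      using div_add_self2[of "2 * (m - d)" "j + m - i"] d by simp
    moreover have "i' + j' = i + j" using 2 by simp
    ultimately show ?thesis by (simp add: parity_def uv mod_Suc)
  qed
qed

abbreviation bishop_palette :: "nat \<Rightarrow> colour set" where
  "bishop_palette m \<equiv> {0} \<times> {1..<m} \<times> {0, 1}"

lemma bishop_colouring_parity:
  "local_colouring (bishop_adj m n) (bishop_colour m (parity m)) (bishop_palette m)"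
proof (rule bishop_colouring)
  fix d u v assume "step m n d u v"
  then show "(0, d, parity m d u) \<in> bishop_palette m"
    using step_bounds[of m n d u v] parity_zero_or_one[of m d u] by auto
qed (rule parity_step)

text \<open>Two steps of class \<open>n / 2\<close> on the square board would leave it, so one colour suffices there.\<close>

lemma bishop_colouring_even_square:
  assumes "even n"
  shows "\<exists>s. local_colouring (bishop_adj n n) (bishop_colour n s)
           (bishop_palette n - {(0, n div 2, 1)})"
proof -
  define s where "s d u = (if 2 * d = n then 0 else parity n d u)" for d u
  have "local_colouring (bishop_adj n n) (bishop_colour n s) (bishop_palette n - {(0, n div 2, 1)})"
  proof (rule bishop_colouring)
    fix d u v w assume uv: "step n n d u v" and vw: "step n n d v w"
    have "2 * d \<noteq> n"
    proof
      assume "2 * d = n"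
      then have "n - d = d" by simp
      then show False using uv vw \<open>2 * d = n\<close> by (cases u; cases v; cases w) auto
    qed
    then show "s d u \<noteq> s d v" using parity_step[OF uv] by (simp add: s_def)
  next
    fix d u v assume "step n n d u v"
    then have d: "d \<in> {1..<n}" using step_bounds[of n n d u v] by simp
    have "s d u \<in> {0, 1}" unfolding s_def using parity_zero_or_one[of n d u] by (auto split: if_splits)
    moreover have "s d u \<noteq> 1 \<or> d \<noteq> n div 2"
      unfolding s_def by (metis assms dvd_mult_div_cancel zero_neq_one)
    ultimately show "(0, d, s d u) \<in> bishop_palette n - {(0, n div 2, 1)}"
      using d by blast
  qed
  then show ?thesis by blast
qed

section \<open>Colourings of the queen graph\<close>

lemma queen_graph_eq:
  "queen_graph m n =
     ({1..m} \<times> {1..n}, {{u, v} | u v. rook_adj m n u v \<or> bishop_adj m n u v})"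
  unfolding queen_graph_def Let_def queen_adj_eq ..

text \<open>The first components keep the two palettes disjoint, so rook and bishop colourings
  combine freely.\<close>

lemma queen_colouring:
  fixes C D :: "colour set"
  assumes R: "local_colouring (rook_adj m n) c C" "C \<subseteq> {1..} \<times> UNIV" "finite C"
    and B: "local_colouring (bishop_adj m n) b D" "D \<subseteq> {0} \<times> UNIV" "finite D"
    and k: "card C + card D \<le> k"
  shows "\<exists>c. proper_edge_colouring (queen_graph m n) k c"
proof -
  have "c u v \<noteq> b u w" if "rook_adj m n u v" "bishop_adj m n u w" for u v w
    using local_colouringD(2)[OF R(1) that(1)] local_colouringD(2)[OF B(1) that(2)] R(2) B(2)
    by fastforce
  note join = local_colouring_join[OF R(1) B(1) this]
  have "finite (C \<union> D)" "card (C \<union> D) \<le> k"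
    using R(3) B(3) k card_Un_le[of C D] by auto
  then show ?thesis
    unfolding queen_graph_eq using local_colouring_imp_proper[OF join] by blast
qed

lemma card_bishop_palette: "card (bishop_palette m) = 2 * (m - 1)"
  by (simp add: card_cartesian_product)

lemma rook_colouring_exists:
  assumes "0 < n"
  shows "\<exists>c :: cell \<Rightarrow> cell \<Rightarrow> colour. \<exists>C. local_colouring (rook_adj m n) c C \<and>
           C \<subseteq> {1..} \<times> UNIV \<and> finite C \<and> card C \<le> m + n - 1"
  by (rule rook_colouring[OF complete_colouring_sum assms])

text \<open>The complete graph on a line of even length saves one colour; if only \<open>m\<close>
  is even, the transposed board is coloured.\<close>

lemma rook_colouring_even:
  assumes "even m \<or> even n" "0 < m" "0 < n"
  shows "\<exists>c :: cell \<Rightarrow> cell \<Rightarrow> colour. \<exists>C. local_colouring (rook_adj m n) c C \<and>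
           C \<subseteq> {1..} \<times> UNIV \<and> finite C \<and> card C \<le> m + n - 2"
proof (cases "even n")
  case True
  then obtain g where g: "complete_colouring n (n - 1) g"
    using complete_colouring_even assms by blast
  have "0 < n - 1" "m + (n - 1) - 1 = m + n - 2" using True assms by presburger+
  then show ?thesis using rook_colouring[OF g, of m] by simp
next
  case False
  then obtain g where g: "complete_colouring m (m - 1) g"
    using complete_colouring_even assms by blast
  have "0 < m - 1" "n + (m - 1) - 1 = m + n - 2" using False assms by presburger+
  then obtain c and C :: "colour set" where "local_colouring (rook_adj n m) c C"
    "C \<subseteq> {1..} \<times> UNIV" "finite C" "card C \<le> m + n - 2"
    using rook_colouring[OF g, of n] by auto
  then show ?thesis using rook_colouring_swap by blast
qed

text \<open>Steps of these classes have length \<open>k\<close> or \<open>k + 1\<close>, while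
  columns differ by at most \<open>2 * k\<close>. Hence both steps have length \<open>k\<close>,
  which fixes their direction, and together they run from corner to corner.\<close>

lemma two_steps_centre:
  assumes n: "n = 2 * k + 1" and d: "d = k \<or> d = k + 1"
    and uv: "step n n d u v" and vw: "step n n d v w"
  shows "v = (k + 1, k + 1)"
proof -
  obtain a b where u: "u = (a, b)" by (cases u)
  obtain x y where v: "v = (x, y)" by (cases v)
  obtain p q where w: "w = (p, q)" by (cases w)
  have "x = k + 1 \<and> y = k + 1"
    using d
  proof
    assume d: "d = k"
    then have nd: "n - d = k + 1" using n by simp
    show ?thesis
      using uv vw n unfolding u v w step.simps nd atLeastAtMost_iff unfolding d
      by - (intro conjI; elim conjE disjE; linarith)
  next
    assume d: "d = k + 1"
    then have nd: "n - d = k" using n by simp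
    show ?thesis
      using uv vw n unfolding u v w step.simps nd atLeastAtMost_iff unfolding d
      by - (intro conjI; elim conjE disjE; linarith)
  qed
  then show ?thesis by (simp add: v)
qed

text \<open>On the square board of odd side \<open>2 * k + 1\<close>, two consecutive steps of class \<open>k\<close> or \<open>k + 1\<close>
  pass through the centre. The second colours of these two classes are thus needed only for one
  edge each, from the centre to a corner, and are reused as a row and as a column colour. In row
  \<open>i\<close> the former is omitted at column \<open>i\<close>, in column \<open>j\<close> the latter at row \<open>n + 1 - j\<close>.\<close>

lemma queen_colouring_odd_square:
  assumes n: "n = 2 * k + 1"
  shows "\<exists>c. proper_edge_colouring (queen_graph n n) (4 * n - 4) c"
proof -
  define z :: cell where "z = (k + 1, k + 1)"
  \<comment> \<open>In the classes \<open>k\<close> and \<open>k + 1\<close> only the step leaving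
    the centre gets the second colour; a step entering the centre gets the first.\<close>
  define s where "s d u = (if d = k \<or> d = k + 1 then if u = z then 1 else 0 else parity n d u)" for d u
  let ?P = "bishop_palette n"
  let ?b = "bishop_colour n s"
  have bishop: "local_colouring (bishop_adj n n) ?b ?P"
  proof (rule bishop_colouring)
    fix d u v w assume uv: "step n n d u v" and vw: "step n n d v w"
    show "s d u \<noteq> s d v"
    proof (cases "d = k \<or> d = k + 1")
      case True
      then have "v = z" using two_steps_centre[OF n _ uv vw] by (simp add: z_def)
      moreover have "u \<noteq> z" using step_right[OF uv] \<open>v = z\<close> by auto
      ultimately have "v = z" "u \<noteq> z" by auto
      then show ?thesis using True unfolding s_def by simp
    next
      case False
      then show ?thesis using parity_step[OF uv] unfolding s_def by simp
    qed
  next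
    fix d u v assume "step n n d u v"
    then have d: "d \<in> {1..<n}" using step_bounds[of n n d u v] by simp
    have "s d u \<in> {0, 1}" unfolding s_def using parity_zero_or_one[of n d u] by (auto split: if_splits)
    then show "(0, d, s d u) \<in> ?P" using d by blast
  qed
  \<comment> \<open>The shifts move the free residue to \<open>0\<close> at the intended cells: a
    loop at column \<open>i\<close> of row \<open>i\<close> would give \<open>2 * n\<close>, and a
    loop at row \<open>n + 1 - j\<close> of column \<open>j\<close> would give \<open>4 * n\<close>.
    The multiples of \<open>n\<close> prevent truncation.\<close>
  let ?x = "\<lambda>u v. (snd u + snd v + 2 * (n - fst u)) mod n"
  let ?y = "\<lambda>u v. (fst u + fst v + (2 * snd u + 2 * n - 2)) mod n"
  let ?rc = "\<lambda>u v. if ?x u v = 0 then (0, k, 1) else (1, ?x u v, 0) :: colour"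
  let ?cc = "\<lambda>u v. if ?y u v = 0 then (0, k + 1, 1) else (2, ?y u v, 0) :: colour"
  let ?R = "{1} \<times> {1..<n} \<times> {0} \<union> ?P" and ?C = "{2} \<times> {1..<n} \<times> {0} \<union> ?P"
  have row: "local_colouring (row_adj n n) ?rc ?R"
  proof (rule local_colouringI)
    fix u v assume uv: "row_adj n n u v"
    then show "row_adj n n v u" by (cases u; cases v) auto
    have "1 \<le> k" using uv by (cases u; cases v) (auto simp: n)
    then show "?rc u v \<in> ?R" by (auto simp: n)
    show "?rc u v = ?rc v u" using uv by (cases u; cases v) (auto simp: add.commute)
  next
    fix u v w assume "row_adj n n u v" "row_adj n n u w" "?rc u v = ?rc u w"
    then show "v = w"
      using add_mod_eq_imp_eq[of "snd u + 2 * (n - fst u)" "snd v" n "snd w"]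
      by (cases u; cases v; cases w) (auto simp: ac_simps split: if_splits)
  qed
  have col: "local_colouring (col_adj n n) ?cc ?C"
  proof (rule local_colouringI)
    fix u v assume uv: "col_adj n n u v"
    then show "col_adj n n v u" by (cases u; cases v) auto
    have "1 \<le> k" using uv by (cases u; cases v) (auto simp: n)
    then show "?cc u v \<in> ?C" by (auto simp: n)
    show "?cc u v = ?cc v u" using uv by (cases u; cases v) (auto simp: add.commute)
  next
    fix u v w assume "col_adj n n u v" "col_adj n n u w" "?cc u v = ?cc u w"
    then show "v = w"
      using add_mod_eq_imp_eq[of "fst u + (2 * snd u + 2 * n - 2)" "fst v" n "fst w"]
      by (cases u; cases v; cases w) (auto simp: ac_simps split: if_splits)
  qed
  have sep: "?rc u v \<noteq> ?cc u w" for u v w :: cell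
    by auto
  have rook: "local_colouring (rook_adj n n) (\<lambda>u v. if row_adj n n u v then ?rc u v else ?cc u v)
      (?R \<union> ?C)"
    by (rule local_colouring_join[OF row col sep])
  \<comment> \<open>The reused colours occur only on the edges from the centre to
    \<open>(n, n)\<close> and to \<open>(1, n)\<close>.\<close>
  have corner: "(u = z \<or> u = (n, n)) \<and> d = k \<or> (u = z \<or> u = (1, n)) \<and> d = k + 1"
    if adj: "bishop_adj n n u v" and "?b u v = (0, d, 1)" "d = k \<or> d = k + 1" for u v d
  proof -
    obtain e where e: "step n n e u v \<or> step n n e v u"
      using adj unfolding bishop_adj_def by blast
    have "e = d" using e that(2) by (auto simp: bishop_colour_step simp del: step.simps)
    have "u = z \<or> v = z \<and> step n n d v u"
      using e
    proof
      assume "step n n e u v"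
      then have "s d u = 1" using that(2) by (simp add: \<open>e = d\<close> bishop_colour_step del: step.simps)
      then show ?thesis using that(3) by (simp add: s_def split: if_splits)
    next
      assume vu: "step n n e v u"
      then have "s d v = 1" using that(2) by (simp add: \<open>e = d\<close> bishop_colour_step del: step.simps)
      then show ?thesis using that(3) vu by (simp add: s_def \<open>e = d\<close> del: step.simps split: if_splits)
    qed
    moreover have "u = (n, n) \<and> d = k \<or> u = (1, n) \<and> d = k + 1" if zu: "step n n d z u"
    proof -
      obtain a b where u: "u = (a, b)" by (cases u)
      have "a = n \<and> b = n \<and> d = k \<or> a = 1 \<and> b = n \<and> d = k + 1"
        using \<open>d = k \<or> d = k + 1\<close> zu n by (auto simp: u z_def)
      then show ?thesis by (simp add: u)
    qed
    ultimately show ?thesis using that(3) by blast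
  qed
  have row_free: "?rc u v \<noteq> ?b u w" if uv: "row_adj n n u v" and uw: "bishop_adj n n u w" for u v w
  proof
    assume eq: "?rc u v = ?b u w"
    have x: "?x u v = 0"
      using eq by (auto simp: bishop_colour_def split: if_splits)
    then have "?b u w = (0, k, 1)" using eq by simp
    \<comment> \<open>Both ends of the edge coloured \<open>(0, k, 1)\<close> lie on the main
      diagonal, where residue \<open>0\<close> is free in the row.\<close>
    then have u: "snd u = fst u"
      using corner[OF uw, of k] by (auto simp: z_def)
    have "snd u + snd v + 2 * (n - fst u) = (n - snd u + snd v) + n * 1"
      using u uv by (cases u; cases v) auto
    then have "(n - snd u + snd v) mod n = 0"
      using x by (metis mod_mult_self2)
    also have "0 = (n - snd u + snd u) mod n"
      using uv by (cases u; cases v) auto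
    finally show False
      using add_mod_eq_imp_eq[of "n - snd u" "snd v" n "snd u"] uv
      by (cases u; cases v) auto
  qed
  have col_free: "?cc u v \<noteq> ?b u w" if uv: "col_adj n n u v" and uw: "bishop_adj n n u w" for u v w
  proof
    assume eq: "?cc u v = ?b u w"
    have y: "?y u v = 0"
      using eq by (auto simp: bishop_colour_def split: if_splits)
    then have "?b u w = (0, k + 1, 1)" using eq by simp
    \<comment> \<open>Likewise both ends of the edge coloured \<open>(0, k + 1, 1)\<close> lie on
      the main anti-diagonal.\<close>
    then have u: "fst u + snd u = n + 1"
      using corner[OF uw, of "k + 1"] by (auto simp: z_def n)
    have "fst u + fst v + (2 * snd u + 2 * n - 2) = (snd u - 1 + fst v) + n * 3"
      using u uv by (cases u; cases v) auto
    then have "(snd u - 1 + fst v) mod n = 0"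
      using y by (metis mod_mult_self2)
    also have "0 = (snd u - 1 + fst u) mod n"
    proof -
      have "snd u - 1 + fst u = n" using u uv by (cases u; cases v) auto
      then show ?thesis by simp
    qed
    finally show False
      using add_mod_eq_imp_eq[of "snd u - 1" "fst v" n "fst u"] uv
      by (cases u; cases v) auto
  qed
  have free: "(if row_adj n n u v then ?rc u v else ?cc u v) \<noteq> ?b u w"
    if "rook_adj n n u v" "bishop_adj n n u w" for u v w
    using row_free[OF _ that(2)] col_free[OF _ that(2)] that(1) by presburger
  \<comment> \<open>Besides the \<open>2 * n - 2\<close> bishop colours there are
    \<open>n - 1\<close> nonzero residues each for rows and for columns.\<close>
  let ?all = "?P \<union> ({1} \<times> {1..<n} \<times> {0} \<union> {2} \<times> {1..<n} \<times> {0})"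
  have "(?R \<union> ?C) \<union> ?P = ?all" by blast
  moreover have "card ?all \<le> 4 * n - 4"
  proof -
    have "card ?all \<le> card ?P + (card ({1::nat} \<times> {1..<n} \<times> {0::nat}) +
        card ({2::nat} \<times> {1..<n} \<times> {0::nat}))"
      by (intro order_trans[OF card_Un_le] add_left_mono card_Un_le)
    also have "\<dots> = 4 * n - 4"
      by (simp only: card_bishop_palette) (simp add: card_cartesian_product)
    finally show ?thesis .
  qed
  ultimately show ?thesis
    using local_colouring_imp_proper[OF local_colouring_join[OF rook bishop free]]
    unfolding queen_graph_eq by simp
qed

section \<open>Degrees and number of edges\<close>

lemma degree_eq_card_neighbours:
  assumes "\<And>u v. R u v \<Longrightarrow> R v u"
  shows "degree (V, {{u, v} | u v. R u v}) u = card {v. R u v}"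
proof -
  have "{e \<in> {{u, v} | u v. R u v}. u \<in> e} = (\<lambda>v. {u, v}) ` {v. R u v}"
    using assms by fastforce
  moreover have "inj_on (\<lambda>v. {u, v}) {v. R u v}"
    by (auto simp: inj_on_def doubleton_eq_iff)
  ultimately show ?thesis by (simp add: degree_def card_image)
qed

lemma queen_degree_eq:
  "degree (queen_graph m n) u = card {v. rook_adj m n u v \<or> bishop_adj m n u v}"
  unfolding queen_graph_eq
proof (rule degree_eq_card_neighbours)
  fix u v assume "rook_adj m n u v \<or> bishop_adj m n u v"
  then show "rook_adj m n v u \<or> bishop_adj m n v u"
    by (cases u; cases v) (auto simp: bishop_adj_def)
qed

lemma queen_neighbours:
  "{v. rook_adj m n u v \<or> bishop_adj m n u v} =
     {v \<in> {1..m} \<times> {1..n}. u \<in> {1..m} \<times> {1..n} \<and> queen_adj u v}"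
  by (auto simp only: queen_adj_eq[symmetric])

text \<open>Every other row contains at most three attacked cells, one each on the column, the
  diagonal and the anti-diagonal. Coinciding cells or cells off the board only weaken the
  bound.\<close>

lemma queen_degree_le:
  assumes "u \<in> {1..m} \<times> {1..n}"
  shows "degree (queen_graph m n) u \<le> (n - 1) + 3 * (m - 1)"
proof -
  obtain i j where u: "u = (i, j)" "i \<in> {1..m}" "j \<in> {1..n}" using assms by auto
  define X where "X = {1..m} - {i}"
  have X: "finite X" "card X = m - 1" using u by (auto simp: X_def)
  let ?A = "Pair i ` ({1..n} - {j})" and ?B = "(\<lambda>x. (x, j)) ` X"
    and ?C = "(\<lambda>x. (x, j + x - i)) ` X" and ?D = "(\<lambda>x. (x, j + i - x)) ` X"
  have "{v. rook_adj m n u v \<or> bishop_adj m n u v} \<subseteq> (?A \<union> ?B) \<union> (?C \<union> ?D)"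
  proof
    fix v assume "v \<in> {v. rook_adj m n u v \<or> bishop_adj m n u v}"
    then have v: "v \<in> {1..m} \<times> {1..n}" "queen_adj u v"
      unfolding queen_neighbours by auto
    obtain x y where xy: "v = (x, y)" by (cases v)
    show "v \<in> (?A \<union> ?B) \<union> (?C \<union> ?D)"
    proof (cases "x = i")
      case True
      then show ?thesis using v by (auto simp: u xy)
    next
      case False
      then have "x \<in> X" "y = j \<or> y = j + x - i \<or> y = j + i - x"
        using v by (auto simp: u xy X_def)
      then show ?thesis by (auto simp: xy)
    qed
  qed
  then have "degree (queen_graph m n) u \<le> card ((?A \<union> ?B) \<union> (?C \<union> ?D))"
    unfolding queen_degree_eq using X by (intro card_mono) auto
  also have "\<dots> \<le> (card ?A + card ?B) + (card ?C + card ?D)"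
    by (intro order_trans[OF card_Un_le] add_mono card_Un_le)
  also have "\<dots> \<le> (card ({1..n} - {j}) + card X) + (card X + card X)"
    using X by (intro add_mono card_image_le) auto
  finally show ?thesis using X u by simp
qed

text \<open>By \<open>pos\<close> the diagonal through \<open>(i, j)\<close> meets every row within
  the board; \<open>D\<close> collects rows in which the anti-diagonal does too. The attacked cells
  listed are all distinct.\<close>

lemma queen_degree_ge:
  assumes u: "i \<in> {1..m}" "j \<in> {1..n}"
    and pos: "\<And>x. x \<in> {1..m} \<Longrightarrow> i < j + x \<and> j + x \<le> n + i"
    and neg: "\<And>x. x \<in> D \<Longrightarrow> x < j + i \<and> j + i \<le> n + x" and D: "D \<subseteq> {1..m} - {i}"
  shows "(n - 1) + 2 * (m - 1) + card D \<le> degree (queen_graph m n) (i, j)"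
proof -
  define X where "X = {1..m} - {i}"
  have X: "finite X" "card X = m - 1" using u by (auto simp: X_def)
  have DX: "D \<subseteq> X" "finite D" using D X by (auto simp: X_def intro: finite_subset)
  let ?A = "Pair i ` ({1..n} - {j})" and ?B = "(\<lambda>x. (x, j)) ` X"
    and ?C = "(\<lambda>x. (x, j + x - i)) ` X" and ?D = "(\<lambda>x. (x, j + i - x)) ` D"
  have card: "card ?A = n - 1" "card ?B = m - 1" "card ?C = m - 1" "card ?D = card D"
    using X u by (auto simp: card_image inj_on_def)
  have "card ((?A \<union> ?B) \<union> (?C \<union> ?D)) = card (?A \<union> ?B) + card (?C \<union> ?D)"
  proof (intro card_Un_disjoint)
    show "(?A \<union> ?B) \<inter> (?C \<union> ?D) = {}"
    proof (intro equals0I)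
      fix p assume p: "p \<in> (?A \<union> ?B) \<inter> (?C \<union> ?D)"
      obtain x y where xy: "p = (x, y)" by (cases p)
      have "x \<in> X" using p DX by (auto simp: xy)
      then have "x \<noteq> i" "i < j + x" using pos[of x] by (auto simp: X_def)
      moreover have "y = j" using p \<open>x \<noteq> i\<close> by (auto simp: xy)
      moreover have "y = j + x - i \<or> x < j + i \<and> y = j + i - x" using p neg by (auto simp: xy)
      ultimately show False by auto
    qed
  qed (use X DX in auto)
  also have "card (?A \<union> ?B) = card ?A + card ?B"
    using X by (intro card_Un_disjoint) (auto simp: X_def)
  also have "card (?C \<union> ?D) = card ?C + card ?D"
  proof (intro card_Un_disjoint)
    show "?C \<inter> ?D = {}"
    proof (intro equals0I)
      fix p assume p: "p \<in> ?C \<inter> ?D"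
      obtain x y where xy: "p = (x, y)" by (cases p)
      have "x \<in> X" "x \<in> D" using p DX by (auto simp: xy)
      then have "x \<noteq> i" "i < j + x" "x < j + i" using pos[of x] neg[of x] by (auto simp: X_def)
      moreover have "y = j + x - i" "y = j + i - x" using p by (auto simp: xy)
      ultimately show False by auto
    qed
  qed (use X DX in auto)
  finally have union: "card ((?A \<union> ?B) \<union> (?C \<union> ?D)) = (n - 1) + 2 * (m - 1) + card D"
    unfolding card by simp
  have "(?A \<union> ?B) \<union> (?C \<union> ?D) \<subseteq> {v. rook_adj m n (i, j) v \<or> bishop_adj m n (i, j) v}"
    unfolding queen_neighbours
  proof
    fix p assume p: "p \<in> (?A \<union> ?B) \<union> (?C \<union> ?D)"
    obtain x y where xy: "p = (x, y)" by (cases p)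
    from p consider "x = i" "y \<in> {1..n} - {j}" | "x \<in> X" "y = j" | "x \<in> X" "y = j + x - i"
      | "x \<in> D" "x \<in> X" "y = j + i - x"
      using DX unfolding xy by blast
    then show "p \<in> {v \<in> {1..m} \<times> {1..n}. (i, j) \<in> {1..m} \<times> {1..n} \<and> queen_adj (i, j) v}"
    proof cases
      case 3
      then show ?thesis using u pos[of x] by (auto simp: xy X_def)
    next
      case 4
      then show ?thesis using u neg[of x] by (auto simp: xy X_def)
    qed (use u in \<open>auto simp: xy X_def\<close>)
  qed
  moreover have "finite {v. rook_adj m n (i, j) v \<or> bishop_adj m n (i, j) v}"
    unfolding queen_neighbours by (rule finite_subset[of _ "{1..m} \<times> {1..n}"]) blast+
  ultimately have "card ((?A \<union> ?B) \<union> (?C \<union> ?D)) \<le> degree (queen_graph m n) (i, j)"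
    unfolding queen_degree_eq by (intro card_mono)
  then show ?thesis unfolding union .
qed

lemma queen_degree_centre:
  assumes "1 \<le> m" "m \<le> n" "m \<noteq> n \<or> odd n"
  shows "((m + 1) div 2, (n + 1) div 2) \<in> {1..m} \<times> {1..n}"
    "3 * m + n - 4 \<le> degree (queen_graph m n) ((m + 1) div 2, (n + 1) div 2)"
proof -
  let ?i = "(m + 1) div 2" and ?j = "(n + 1) div 2"
  have "1 \<le> ?i" "?i \<le> m" "1 \<le> ?j" "?j \<le> n" using assms by presburger+
  then show *: "(?i, ?j) \<in> {1..m} \<times> {1..n}" by simp
  \<comment> \<open>On a square board these bounds hold because the side is odd; for
    \<open>m < n\<close> there is room for the rounding.\<close>
  have le: "?i \<le> ?j \<and> ?j + m \<le> n + ?i \<and> m < ?j + ?i \<and> ?j + ?i \<le> n + 1"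
  proof (cases "m = n")
    case True
    then obtain k where "n = 2 * k + 1" using assms by (auto elim: oddE)
    then show ?thesis using True by simp
  next
    case False
    then have "m < n" using assms by simp
    then show ?thesis by (intro conjI) linarith+
  qed
  have "(n - 1) + 2 * (m - 1) + card ({1..m} - {?i}) \<le> degree (queen_graph m n) (?i, ?j)"
  proof (rule queen_degree_ge)
    fix x assume "x \<in> {1..m}"
    then show "?i < ?j + x \<and> ?j + x \<le> n + ?i" using le unfolding atLeastAtMost_iff by linarith
  next
    fix x assume "x \<in> {1..m} - {?i}"
    then show "x < ?j + ?i \<and> ?j + ?i \<le> n + x"
      using le unfolding atLeastAtMost_iff Diff_iff by linarith
  qed (use * in blast)+
  moreover have "card ({1..m} - {?i}) = m - 1" using * by (simp only: card_Diff_singleton mem_Sigma_iff) simp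
  ultimately show "3 * m + n - 4 \<le> degree (queen_graph m n) (?i, ?j)"
    using assms by auto
qed

text \<open>The anti-diagonal through this cell has \<open>i + j = n\<close> and misses row
  \<open>n\<close>, which costs one neighbour.\<close>

lemma queen_degree_centre_even_square:
  assumes "1 \<le> n" "even n"
  shows "(n div 2, n div 2) \<in> {1..n} \<times> {1..n}"
    "4 * n - 5 \<le> degree (queen_graph n n) (n div 2, n div 2)"
proof -
  let ?i = "n div 2"
  have n: "n = 2 * ?i" "0 < ?i" using assms by auto
  show *: "(?i, ?i) \<in> {1..n} \<times> {1..n}" using assms by auto
  have "(n - 1) + 2 * (n - 1) + card ({1..<n} - {?i}) \<le> degree (queen_graph n n) (?i, ?i)"
  proof (rule queen_degree_ge)
    fix x assume "x \<in> {1..n}"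
    then show "?i < ?i + x \<and> ?i + x \<le> n + ?i" unfolding atLeastAtMost_iff by linarith
  next
    fix x assume "x \<in> {1..<n} - {?i}"
    then show "x < ?i + ?i \<and> ?i + ?i \<le> n + x"
      using n unfolding atLeastLessThan_iff Diff_iff by linarith
  next
    show "{1..<n} - {?i} \<subseteq> {1..n} - {?i}" by auto
  qed (use * in blast)+
  moreover have "card ({1..<n} - {?i}) = n - 2"
  proof -
    have "?i \<in> {1..<n}" using n unfolding atLeastLessThan_iff by linarith
    then show ?thesis by (simp only: card_Diff_singleton card_atLeastLessThan)
  qed
  ultimately show "4 * n - 5 \<le> degree (queen_graph n n) (?i, ?i)"
    using n by linarith
qed

section \<open>Counting edges and overfullness\<close>

lemma sum_distance_to_end: "2 * (\<Sum>d\<in>{1..<n}. n - d) = n * (n - 1)" for n :: nat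
proof -
  have "(\<Sum>d\<in>{1..<n}. n - d) = (\<Sum>d\<in>{1..<n}. d)"
    by (rule sum.reindex_bij_witness[of _ "\<lambda>d. n - d" "\<lambda>d. n - d"]) auto
  also have "2 * \<dots> = n * (n - 1)"
    by (induction n) (auto simp: algebra_simps Suc_diff_le sum.atLeastLessThan_Suc
        gr0_conv_Suc le_Suc_eq elim: not0_implies_Suc)
  finally show ?thesis .
qed

lemma sum_diff_mult_diff:
  assumes "1 \<le> m" "m \<le> n"
  shows "6 * (\<Sum>d\<in>{1..<m}. (real m - real d) * (real n - real d)) =
    3 * (real n - real m) * real m * (real m - 1) + real m * (real m - 1) * (2 * real m - 1)"
proof -
  \<comment> \<open>With the difference \<open>e\<close> fixed and the sum reversed, induction on
    \<open>m\<close> applies.\<close>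
  define e where "e = n - m"
  have n: "real n = real m + real e" using assms by (simp add: e_def)
  have "(\<Sum>d\<in>{1..<m}. (real m - real d) * (real n - real d)) = (\<Sum>d\<in>{1..<m}. real d * (real d + real e))"
    by (rule sum.reindex_bij_witness[of _ "\<lambda>d. m - d" "\<lambda>d. m - d"]) (auto simp: n algebra_simps)
  also have "6 * \<dots> = 3 * real e * real m * (real m - 1) + real m * (real m - 1) * (2 * real m - 1)"
    using assms(1)
    by (induction m rule: dec_induct) (simp_all add: algebra_simps)
  finally show ?thesis by (simp add: n)
qed

text \<open>A move of length \<open>d\<close> is indexed by \<open>d\<close> and the least row and
  column it touches. Each position of a square with side displacement \<open>d\<close> carries one
  diagonal and one anti-diagonal move, whence the factor 2.\<close>

lemma card_queen_edges_ge:
  "m * (\<Sum>d\<in>{1..<n}. n - d) + n * (\<Sum>d\<in>{1..<m}. m - d) + 2 * (\<Sum>d\<in>{1..<m}. (m - d) * (n - d))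
     \<le> card (edges (queen_graph m n))"
proof -
  define I1 where "I1 = (SIGMA d:{1..<n}. {1..m} \<times> {1..n - d})"
  define I2 where "I2 = (SIGMA d:{1..<m}. {1..m - d} \<times> {1..n})"
  define I3 where "I3 = (SIGMA d:{1..<m}. {1..m - d} \<times> {1..n - d})"
  have fin: "finite I1" "finite I2" "finite I3" by (auto simp: I1_def I2_def I3_def)
  have card: "card I1 = m * (\<Sum>d\<in>{1..<n}. n - d)" "card I2 = n * (\<Sum>d\<in>{1..<m}. m - d)"
    "card I3 = (\<Sum>d\<in>{1..<m}. (m - d) * (n - d))"
    by (simp_all add: I1_def I2_def I3_def sum_distrib_left mult.commute)
  define f1 :: "nat \<times> cell \<Rightarrow> cell set" where "f1 = (\<lambda>(d, i, j). {(i, j), (i, j + d)})"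
  define f2 :: "nat \<times> cell \<Rightarrow> cell set" where "f2 = (\<lambda>(d, i, j). {(i, j), (i + d, j)})"
  define f3 :: "nat \<times> cell \<Rightarrow> cell set" where "f3 = (\<lambda>(d, i, j). {(i, j), (i + d, j + d)})"
  define f4 :: "nat \<times> cell \<Rightarrow> cell set" where "f4 = (\<lambda>(d, i, j). {(i, j + d), (i + d, j)})"
  have inj: "inj_on f1 I1" "inj_on f2 I2" "inj_on f3 I3" "inj_on f4 I3"
    by (auto simp: inj_on_def doubleton_eq_iff f1_def f2_def f3_def f4_def)
  have dj: "(f1 ` I1 \<union> f2 ` I2) \<inter> (f3 ` I3 \<union> f4 ` I3) = {}" "f1 ` I1 \<inter> f2 ` I2 = {}"
    "f3 ` I3 \<inter> f4 ` I3 = {}"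
    by (auto simp: doubleton_eq_iff f1_def f2_def f3_def f4_def I1_def I2_def I3_def)
  have "card ((f1 ` I1 \<union> f2 ` I2) \<union> (f3 ` I3 \<union> f4 ` I3)) = (card I1 + card I2) + (card I3 + card I3)"
    using dj fin inj by (simp add: card_Un_disjoint card_image)
  moreover have "(f1 ` I1 \<union> f2 ` I2) \<union> (f3 ` I3 \<union> f4 ` I3) \<subseteq> edges (queen_graph m n)"
  proof
    fix e assume "e \<in> (f1 ` I1 \<union> f2 ` I2) \<union> (f3 ` I3 \<union> f4 ` I3)"
    then obtain d i j where *: "e = f1 (d, i, j) \<and> (d, i, j) \<in> I1 \<or> e = f2 (d, i, j) \<and> (d, i, j) \<in> I2 \<or>
        e = f3 (d, i, j) \<and> (d, i, j) \<in> I3 \<or> e = f4 (d, i, j) \<and> (d, i, j) \<in> I3"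
      by fast
    have "\<exists>u v. e = {u, v} \<and> u \<in> {1..m} \<times> {1..n} \<and> v \<in> {1..m} \<times> {1..n} \<and> queen_adj u v"
      using * unfolding f1_def f2_def f3_def f4_def split
      by (elim disjE conjE; intro exI conjI; assumption?)
        (auto simp: I1_def I2_def I3_def)
    then show "e \<in> edges (queen_graph m n)" by (simp add: queen_graph_def Let_def)
  qed
  moreover have "finite (edges (queen_graph m n))"
  proof (rule finite_subset)
    show "edges (queen_graph m n) \<subseteq> Pow ({1..m} \<times> {1..n})"
      by (auto simp: queen_graph_def Let_def)
  qed simp
  ultimately show ?thesis
    using card card_mono by (metis (no_types, lifting) add.assoc mult_2)
qed

lemma queen_overfull:
  assumes m: "1 \<le> m" "m \<le> n" and n: "2 \<le> n"
    and large: "real n \<ge> 1 / 3 * (2 * real m ^ 3 - 11 * real m + 18)"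
  shows "(3 * m + n - 4) * (m * n - 1) < 2 * card (edges (queen_graph m n))"
proof -
  let ?M = "real m" and ?N = "real n"
  let ?S = "\<Sum>d\<in>{1..<m}. (?M - real d) * (?N - real d)"
  have S: "real (\<Sum>d\<in>{1..<m}. (m - d) * (n - d)) = ?S"
    unfolding of_nat_sum using m by (intro sum.cong) auto
  have two: "2 * real (\<Sum>d\<in>{1..<k}. k - d) = real k * (real k - 1)" if "1 \<le> k" for k
    using arg_cong[OF sum_distance_to_end[of k], of real] that by (simp del: of_nat_sum)
  have "real (m * (\<Sum>d\<in>{1..<n}. n - d) + n * (\<Sum>d\<in>{1..<m}. m - d) + 2 * (\<Sum>d\<in>{1..<m}. (m - d) * (n - d)))
      \<le> real (card (edges (queen_graph m n)))"
    by (intro of_nat_mono card_queen_edges_ge)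
  then have "?M * (2 * real (\<Sum>d\<in>{1..<n}. n - d)) + ?N * (2 * real (\<Sum>d\<in>{1..<m}. m - d)) + 4 * ?S
      \<le> 2 * real (card (edges (queen_graph m n)))"
    unfolding of_nat_add of_nat_mult S by (simp add: algebra_simps del: of_nat_sum)
  then have "?M * (?N * (?N - 1)) + ?N * (?M * (?M - 1)) + 4 * ?S \<le> 2 * real (card (edges (queen_graph m n)))"
    using two[of n] two[of m] m by simp
  \<comment> \<open>By the closed form of the sum, the right side minus the left side equals
    \<open>n - (2 * m ^ 3 - 11 * m + 12) / 3\<close>, which is at least 2 by
    \<open>large\<close>.\<close>
  moreover have "(3 * ?M + ?N - 4) * (?M * ?N - 1) < ?M * (?N * (?N - 1)) + ?N * (?M * (?M - 1)) + 4 * ?S"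
    using sum_diff_mult_diff[OF m] large
    by (simp add: algebra_simps power3_eq_cube)
  moreover have "real ((3 * m + n - 4) * (m * n - 1)) = (3 * ?M + ?N - 4) * (?M * ?N - 1)"
  proof -
    have "1 \<le> m * n" using m by simp
    then show ?thesis using m n by simp
  qed
  ultimately have "real ((3 * m + n - 4) * (m * n - 1)) < real (2 * card (edges (queen_graph m n)))"
    by simp
  then show ?thesis by (simp only: of_nat_less_iff)
qed

section \<open>Matching the number of colours with the degree bounds\<close>

lemma vertices_queen_graph: "vertices (queen_graph m n) = {1..m} \<times> {1..n}"
  by (simp add: queen_graph_eq)

theorem theorem6:
  fixes m n :: nat
  assumes "1 \<le> m" and "m \<le> n"
  shows "(even m \<or> even n \<or> (m = n \<and> odd n) \<longrightarrow> class_1 (queen_graph m n)) \<and>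
         (odd m \<and> odd n \<and> real n \<ge> 1 / 3 * (2 * real m ^ 3 - 11 * real m + 18)
            \<longrightarrow> class_2 (queen_graph m n))"
proof (intro conjI impI)
  assume "even m \<or> even n \<or> (m = n \<and> odd n)"
  then consider "m = n" "even n" | "m = n" "odd n" | "even m \<or> even n" "m \<noteq> n" by blast
  then show "class_1 (queen_graph m n)"
  proof cases
    case 1
    obtain s where B: "local_colouring (bishop_adj n n) (bishop_colour n s)
        (bishop_palette n - {(0, n div 2, 1)})"
      using bishop_colouring_even_square 1 by blast
    obtain c and C :: "colour set" where C: "local_colouring (rook_adj n n) c C"
      "C \<subseteq> {1..} \<times> UNIV" "finite C" "card C \<le> n + n - 2"
      using rook_colouring_even[of n n] 1 assms by auto
    have "(0, n div 2, 1) \<in> bishop_palette n" using 1 assms by auto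
    then have "card (bishop_palette n - {(0, n div 2, 1)}) = 2 * (n - 1) - 1"
      by (simp only: card_Diff_singleton card_bishop_palette)
    then have "card C + card (bishop_palette n - {(0, n div 2, 1)}) \<le> 4 * n - 5"
      using C(4) 1 assms by auto
    then have "\<exists>c. proper_edge_colouring (queen_graph n n) (4 * n - 5) c"
      by (intro queen_colouring[OF C(1-3) B]) auto
    then show ?thesis
      using class_1I[OF queen_graph_simple] queen_degree_centre_even_square[of n] 1 assms
      unfolding vertices_queen_graph by metis
  next
    case 2
    then obtain k where "n = 2 * k + 1" by (auto elim: oddE)
    then have "\<exists>c. proper_edge_colouring (queen_graph n n) (4 * n - 4) c"
      by (rule queen_colouring_odd_square)
    moreover have "3 * n + n - 4 = 4 * n - 4" by simp
    ultimately show ?thesis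
      using class_1I[OF queen_graph_simple] queen_degree_centre[of n n] 2 assms
      unfolding vertices_queen_graph by (metis order_refl)
  next
    case 3
    obtain c and C :: "colour set" where C: "local_colouring (rook_adj m n) c C"
      "C \<subseteq> {1..} \<times> UNIV" "finite C" "card C \<le> m + n - 2"
      using rook_colouring_even[of m n] 3 assms by auto
    have "card C + card (bishop_palette m) \<le> 3 * m + n - 4"
      unfolding card_bishop_palette using C(4) assms 3 by linarith
    then have "\<exists>c. proper_edge_colouring (queen_graph m n) (3 * m + n - 4) c"
      by (intro queen_colouring[OF C(1-3) bishop_colouring_parity]) auto
    then show ?thesis
      using class_1I[OF queen_graph_simple] queen_degree_centre[of m n] 3 assms
      unfolding vertices_queen_graph by metis
  qed
next
  assume *: "odd m \<and> odd n \<and> real n \<ge> 1 / 3 * (2 * real m ^ 3 - 11 * real m + 18)"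
  \<comment> \<open>For \<open>m = 1\<close> the bound reads \<open>n \<ge> 3\<close>, which
    excludes the board with a single cell.\<close>
  have n: "2 \<le> n"
  proof (cases "m = 1")
    case True
    then show ?thesis using * by simp
  qed (use assms in linarith)
  let ?k = "3 * m + n - 4"
  obtain c and C :: "colour set" where C: "local_colouring (rook_adj m n) c C"
    "C \<subseteq> {1..} \<times> UNIV" "finite C" "card C \<le> m + n - 1"
    using rook_colouring_exists[of n m] n by auto
  \<comment> \<open>The count is \<open>(m + n - 1) + 2 * (m - 1)\<close>, one more than the maximum
    degree.\<close>
  have "card C + card (bishop_palette m) \<le> Suc ?k"
    unfolding card_bishop_palette using C(4) assms n by linarith
  then obtain c' where c': "proper_edge_colouring (queen_graph m n) (Suc ?k) c'"
    using queen_colouring[OF C(1-3) bishop_colouring_parity] by auto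
  have V: "card (vertices (queen_graph m n)) = m * n"
    by (simp add: vertices_queen_graph)
  show "class_2 (queen_graph m n)"
  proof (rule class_2I[OF queen_graph_simple c'])
    show "((m + 1) div 2, (n + 1) div 2) \<in> vertices (queen_graph m n)"
      "?k \<le> degree (queen_graph m n) ((m + 1) div 2, (n + 1) div 2)"
      using queen_degree_centre[of m n] * assms by (auto simp only: vertices_queen_graph)
    show "degree (queen_graph m n) u \<le> ?k" if "u \<in> vertices (queen_graph m n)" for u
      using queen_degree_le[of u m n] that assms n by (simp add: vertices_queen_graph)
    show "odd (card (vertices (queen_graph m n)))" using * by (simp add: V)
    show "?k * (card (vertices (queen_graph m n)) - 1) < 2 * card (edges (queen_graph m n))"
      unfolding V using queen_overfull assms n * by blast
  qed
qed

end
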